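(* Let $k_n^{\#2}$ and $k_n^{\#3}$ be the numbers of rows with the value true in the truth tables of all the bracketed m-implications with $n$ variables, type 2, case 2 and case 3 respectively. Then, as $n\to\infty$, both $k_n^{\#2}$ and $k_n^{\#3}$ satisfy $$k_n^{\#2} \sim \left(\frac{2-\sqrt{2}}{4}\right)\frac{2^{3n-2}}{\sqrt{\pi n^3}},\qquad k_n^{\#3} \sim \left(\frac{2-\sqrt{2}}{4}\right)\frac{2^{3n-2}}{\sqrt{\pi n^3}}.$$
   Context: The m-implication of type 2 is the connective $\psi\leftharpoonup\phi\equiv\neg\psi\to\phi$, which has value 0 (false) exactly when $\psi$ and $\phi$ both have value 0, and value 1 (true) otherwise. A bracketed formula with $n$ distinct variables is obtained from $p_1\leftharpoonup p_2\leftharpoonup\cdots\leftharpoonup p_n$ (variables in this fixed order) by fully inserting brackets; for $n\ge2$ it has the form $\psi\leftharpoonup\phi$ with $\psi$ a bracketing of $p_1\leftharpoonup\cdots\leftharpoonup p_i$ and $\phi$ a bracketing of $p_{i+1}\leftharpoonup\cdots\leftharpoonup p_n$ for some $1\le i\le n-1$. A row is a pair consisting of a bracketed formula and a valuation of $p_1,\dots,p_n$ in $\{0,1\}$. For $n\ge2$, $k_n^{\#2}$ (case 2) counts the rows (over all bracketed formulae in $n$ variables) for which $\psi$ has value 1 and $\phi$ has value 0, and $k_n^{\#3}$ (case 3) counts those for which $\psi$ has value 0 and $\phi$ has value 1; in both cases $\psi\leftharpoonup\phi$ is true. $u_n\sim v_n$ means $u_n/v_n\to1$. *)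

theory Defs
  imports Complex_Main "HOL-Library.FuncSet" "HOL-Library.Landau_Symbols"
begin

datatype formula = Var nat | MImp formula formula

text \<open>The m-implication of type 2.\<close>

definition mimp :: "bool \<Rightarrow> bool \<Rightarrow> bool" where
  "mimp a b \<longleftrightarrow> (\<not> a \<longrightarrow> b)"

primrec eval :: "(nat \<Rightarrow> bool) \<Rightarrow> formula \<Rightarrow> bool" where
  "eval v (Var i) = v i"
| "eval v (MImp \<psi> \<phi>) = mimp (eval v \<psi>) (eval v \<phi>)"

text \<open>\<open>bracketing i j \<chi>\<close>: the formula \<open>\<chi>\<close> arises by fully bracketing the chain of
  m-implications through the variables with indices \<open>i, i + 1, \<dots>, j\<close>, in this order;
  this forces \<open>i \<le> j\<close>.\<close>

inductive bracketing :: "nat \<Rightarrow> nat \<Rightarrow> formula \<Rightarrow> bool" where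
  bracketing_Var: "bracketing i i (Var i)"
| bracketing_MImp: "bracketing i m \<psi> \<Longrightarrow> bracketing (Suc m) j \<phi> \<Longrightarrow> bracketing i j (MImp \<psi> \<phi>)"

text \<open>Valuations are extensional functions on \<open>{1..n}\<close>, so that there are exactly
  \<open>2 ^ n\<close> of them.\<close>

definition rows :: "nat \<Rightarrow> (formula \<times> (nat \<Rightarrow> bool)) set" where
  "rows n = {\<chi>. bracketing 1 n \<chi>} \<times> ({1..n} \<rightarrow>\<^sub>E UNIV)"

definition k_case2 :: "nat \<Rightarrow> nat" where
  "k_case2 n = card {(\<chi>, v) \<in> rows n. \<exists>\<psi> \<phi>. \<chi> = MImp \<psi> \<phi> \<and> eval v \<psi> \<and> \<not> eval v \<phi>}"

definition k_case3 :: "nat \<Rightarrow> nat" where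
  "k_case3 n = card {(\<chi>, v) \<in> rows n. \<exists>\<psi> \<phi>. \<chi> = MImp \<psi> \<phi> \<and> \<not> eval v \<psi> \<and> eval v \<phi>}"

end

theory Submission
  imports Defs "HOL-Analysis.Analysis" "HOL-Real_Asymp.Real_Asymp"
begin

text \<open>
  The type-2 connective is disjunction, so a bracketing of \<open>p\<^sub>i, \<dots>, p\<^sub>j\<close> is false under exactly one
  valuation of these variables. Hence, with \<open>c\<^sub>n\<close> the number of bracketings of \<open>n\<close> variables, both
  counts equal \<open>\<Sum>\<^sub>j c\<^sub>j (2^(n - j) - 1) c\<^sub>(n - j)\<close>. Divided by \<open>2^n c\<^sub>n\<close>, the main summand
  is \<open>2^(-j) c\<^sub>j c\<^sub>(n - j) / c\<^sub>n\<close>, which tends to \<open>c\<^sub>j 8^(-j)\<close>. It is at most \<open>2^(-j)\<close>, because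
  \<open>c\<^sub>j c\<^sub>(n - j)\<close> is one of the summands in the convolution recurrence for \<open>c\<^sub>n\<close>. By Tannery's
  theorem the quotient tends to \<open>\<Sum>\<^sub>j c\<^sub>j 8^(-j) = (1 - sqrt (1 - 4/8)) / 2 = (2 - sqrt 2) / 4\<close>,
  and \<open>c\<^sub>n\<close> is asymptotic to \<open>4^n / (4 sqrt (pi n^3))\<close> by Euler's limit for \<open>Gamma (-1/2)\<close>.
\<close>

section \<open>Bracketings\<close>

inductive_cases bracketing_VarE: "bracketing i j (Var k)"
inductive_cases bracketing_MImpE: "bracketing i j (MImp \<psi> \<phi>)"

lemma bracketing_le: "bracketing i j \<theta> \<Longrightarrow> i \<le> j"
  by (induction rule: bracketing.induct) auto

text \<open>\<open>mimp\<close> is disjunction, so the position of the brackets does not affect the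
  value; the two index ranges of a split glue together because \<open>i <= m\<close> and
  \<open>Suc m <= j\<close>.\<close>

lemma bracketing_eval_iff:
  assumes "bracketing i j \<theta>"
  shows "eval v \<theta> \<longleftrightarrow> (\<exists>k\<in>{i..j}. v k)"
  using assms
proof (induction rule: bracketing.induct)
  case (bracketing_MImp i m \<psi> j \<phi>)
  then have "i \<le> m" "Suc m \<le> j"
    by (auto dest: bracketing_le)
  then have "{i..j} = {i..m} \<union> {Suc m..j}"
    by auto
  with bracketing_MImp.IH show ?case
    by (auto simp: mimp_def)
qed auto

text \<open>The left subformula determines the split point, and then the right one determines the
  end. Hence formulae with different split points differ, so that counts over split points add
  up.\<close>

lemma bracketing_right_unique:
  assumes "bracketing i j \<theta>" "bracketing i j' \<theta>"
  shows "j = j'"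
  using assms
proof (induction arbitrary: j' rule: bracketing.induct)
  case (bracketing_Var i)
  then show ?case
    by (auto elim: bracketing_VarE)
next
  case (bracketing_MImp i m \<psi> j \<phi>)
  then show ?case
    by (metis bracketing_MImpE)
qed

definition split_bracketings :: "nat \<Rightarrow> nat \<Rightarrow> nat \<Rightarrow> formula set" where
  "split_bracketings i m j =
     (\<lambda>(\<psi>, \<phi>). MImp \<psi> \<phi>) ` ({\<psi>. bracketing i m \<psi>} \<times> {\<phi>. bracketing (Suc m) j \<phi>})"

lemma bracketings_single: "{\<theta>. bracketing i i \<theta>} = {Var i}"
proof -
  have "\<theta> = Var i" if "bracketing i i \<theta>" for \<theta>
    using that by cases (auto dest!: bracketing_le)
  then show ?thesis
    by (auto intro: bracketing_Var)
qed

lemma bracketings_split: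
  assumes "i < j"
  shows "{\<theta>. bracketing i j \<theta>} = (\<Union>m\<in>{i..<j}. split_bracketings i m j)"
proof -
  have "\<exists>m\<in>{i..<j}. \<theta> \<in> split_bracketings i m j" if "bracketing i j \<theta>" for \<theta>
    using that
  proof cases
    case (bracketing_MImp m \<psi> \<phi>)
    then have "m \<in> {i..<j}"
      by (auto dest!: bracketing_le)
    with bracketing_MImp show ?thesis
      by (auto simp: split_bracketings_def)
  qed (use assms in simp)
  moreover have "bracketing i j \<theta>" if "\<theta> \<in> split_bracketings i m j" for \<theta> m
    using that by (auto simp: split_bracketings_def intro: bracketing_MImp)
  ultimately show ?thesis
    by blast
qed

lemma split_bracketings_disjoint:
  "m \<noteq> m' \<Longrightarrow> split_bracketings i m j \<inter> split_bracketings i m' j = {}"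
  by (auto simp: split_bracketings_def dest: bracketing_right_unique)

lemma card_split_bracketings:
  "card (split_bracketings i m j) =
     card {\<psi>. bracketing i m \<psi>} * card {\<phi>. bracketing (Suc m) j \<phi>}"
  unfolding split_bracketings_def
  by (subst card_image) (auto simp: inj_on_def card_cartesian_product)

lemma finite_bracketings: "finite {\<theta>. bracketing i j \<theta>}"
proof (induction "j - i" arbitrary: i j rule: less_induct)
  case less
  show ?case
  proof (cases "i < j")
    case True
    have "finite (split_bracketings i m j)" if "m \<in> {i..<j}" for m
      using less[of m i] less[of j "Suc m"] that by (auto simp: split_bracketings_def)
    with True show ?thesis
      by (simp add: bracketings_split)
  next
    case False
    then consider "i = j" | "j < i"
      by linarith
    then show ?thesis
    proof cases
      case 1
      then show ?thesis by (simp add: bracketings_single)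
    next
      case 2
      then have "{\<theta>. bracketing i j \<theta>} = {}"
        by (auto dest: bracketing_le)
      then show ?thesis by (simp only: finite.emptyI)
    qed
  qed
qed

lemma finite_split_bracketings: "finite (split_bracketings i m j)"
  by (simp add: split_bracketings_def finite_bracketings)


section \<open>Catalan numbers\<close>

text \<open>The coefficients of \<open>(1 - sqrt (1 - 4 * x)) / 2\<close>, i.e. Catalan numbers with the index
  shifted by one.\<close>

definition shifted_catalan :: "nat \<Rightarrow> real" where
  "shifted_catalan n = (if n = 0 then 0 else - (1/2) * (-4) ^ n * ((1/2) gchoose n))"

lemma shifted_catalan_0: "shifted_catalan 0 = 0"
  and shifted_catalan_1: "shifted_catalan (Suc 0) = 1"
  by (simp_all add: shifted_catalan_def)

text \<open>This is the ratio of consecutive binomial coefficients. It fails at index 0, where the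
  value is set to 0 instead of the -1/2 that the general expression would give.\<close>

lemma shifted_catalan_Suc:
  assumes "n > 0"
  shows "shifted_catalan (Suc n) = (4 * real n - 2) / (real n + 1) * shifted_catalan n"
proof -
  have "(1/2 :: real) gchoose Suc n = (1/2 gchoose n) * (1/2 - real n) / (real n + 1)"
    using gbinomial_mult_1[of "1/2 :: real" n] by (simp add: field_simps)
  then have "shifted_catalan (Suc n) =
      - (1/2) * (-4) ^ Suc n * ((1/2 gchoose n) * (1/2 - real n) / (real n + 1))"
    by (simp only: shifted_catalan_def) simp
  then show ?thesis
    using assms by (simp add: shifted_catalan_def field_simps)
qed

lemma shifted_catalan_pos: "n > 0 \<Longrightarrow> shifted_catalan n > 0"
proof (induction n rule: nat_induct_non_zero)
  case (Suc n)
  then show ?case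
    by (auto simp: shifted_catalan_Suc intro!: mult_pos_pos divide_pos_pos)
qed (simp add: shifted_catalan_1)

lemma shifted_catalan_nonneg: "shifted_catalan n \<ge> 0"
  using shifted_catalan_pos[of n] by (cases "n = 0") (auto simp: shifted_catalan_0)

text \<open>The numbers \<open>g i\<close> are the coefficients of sqrt(1 - 4x), whose square 1 - 4x
  has no term of degree at least 2; Vandermonde's identity expresses this squaring. The two end
  terms contribute \<open>2 * g n\<close>, and \<open>shifted_catalan i\<close> is
  \<open>- g i / 2\<close> for positive \<open>i\<close>.\<close>

lemma shifted_catalan_convolution:
  assumes "n \<ge> 2"
  shows "(\<Sum>i=1..<n. shifted_catalan i * shifted_catalan (n - i)) = shifted_catalan n"
proof -
  define g where "g i = (-4) ^ i * ((1/2 :: real) gchoose i)" for i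
  have "(\<Sum>i=0..n. g i * g (n - i)) =
        (-4) ^ n * (\<Sum>i=0..n. ((1/2 :: real) gchoose i) * ((1/2) gchoose (n - i)))"
    unfolding sum_distrib_left g_def
    by (intro sum.cong refl) (simp add: algebra_simps flip: power_add)
  also have "\<dots> = (-4) ^ n * ((1 :: real) gchoose n)"
    by (subst gbinomial_Vandermonde) simp
  also have "(1 :: real) gchoose n = 0"
    using assms binomial_gbinomial[of 1 n, where 'a = real] by (simp add: binomial_eq_0)
  finally have "(\<Sum>i=0..n. g i * g (n - i)) = 0"
    by simp
  moreover have "{0..n} = insert 0 (insert n {1..<n})"
    using assms by auto
  ultimately have "g 0 * g n + (g n * g 0 + (\<Sum>i=1..<n. g i * g (n - i))) = 0"
    using assms by simp
  moreover have "g 0 = 1"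
    by (simp add: g_def)
  ultimately have "(\<Sum>i=1..<n. g i * g (n - i)) = - 2 * g n"
    by simp
  moreover have "(\<Sum>i=1..<n. shifted_catalan i * shifted_catalan (n - i)) =
      (\<Sum>i=1..<n. g i * g (n - i)) / 4"
    unfolding sum_divide_distrib
    by (intro sum.cong refl) (auto simp: shifted_catalan_def g_def)
  ultimately show ?thesis
    using assms by (simp add: shifted_catalan_def g_def)
qed

text \<open>For 0 < j < n the product is one term of a convolution with nonnegative terms; at the
  ends one factor is \<open>shifted_catalan 0\<close>, which is 0.\<close>

lemma shifted_catalan_mult_le:
  "j \<le> n \<Longrightarrow> shifted_catalan j * shifted_catalan (n - j) \<le> shifted_catalan n"
proof (cases "j \<in> {1..<n}")
  case True
  then have "shifted_catalan j * shifted_catalan (n - j) \<le>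
      (\<Sum>i=1..<n. shifted_catalan i * shifted_catalan (n - i))"
    by (intro member_le_sum) (auto simp: shifted_catalan_nonneg)
  also have "\<dots> = shifted_catalan n"
    using True by (intro shifted_catalan_convolution) auto
  finally show ?thesis .
next
  assume "j \<le> n"
  case False
  with \<open>j \<le> n\<close> have "j = 0 \<or> n - j = 0"
    by auto
  then show ?thesis
    by (auto simp: shifted_catalan_0 shifted_catalan_nonneg)
qed

section \<open>Generating function at 1/8 and growth of the Catalan numbers\<close>

text \<open>The generating function (1 - sqrt(1 - 4x)) / 2 is evaluated at x = 1/8 through the
  binomial series of sqrt(1 - 1/2).\<close>

lemma shifted_catalan_sums: "(\<lambda>n. shifted_catalan n / 8 ^ n) sums ((2 - sqrt 2) / 4)"
proof -
  have "(\<lambda>n. ((1/2) gchoose n) * (-1/2) ^ n) sums sqrt (1 + (-1/2 :: real))"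
    by (rule sqrt_series) simp
  from sums_mult[OF this, of "-1/2"]
  have "(\<lambda>n. - (1/2) * (((1/2) gchoose n) * (-1/2 :: real) ^ n)) sums (- (1/2) * sqrt (1/2))"
    by simp
  \<comment> \<open>This corrects the constant term from -1/2 to
    \<open>shifted_catalan 0 = 0\<close>.\<close>
  moreover have "(\<lambda>n. if n = 0 then 1/2 else 0) sums (1/2 :: real)"
    using sums_single[of 0 "\<lambda>_. 1/2 :: real"] by simp
  ultimately have "(\<lambda>n. - (1/2) * (((1/2) gchoose n) * (-1/2) ^ n) + (if n = 0 then 1/2 else 0))
      sums (- (1/2) * sqrt (1/2) + 1/2 :: real)"
    by (rule sums_add)
  moreover have "- (1/2) * (((1/2) gchoose n) * (-1/2) ^ n) + (if n = 0 then 1/2 else 0)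
      = shifted_catalan n / 8 ^ n" for n
  proof -
    have "(-1/2 :: real) ^ n = (-4) ^ n / 8 ^ n"
      by (simp flip: power_divide)
    then show ?thesis
      by (simp add: shifted_catalan_def)
  qed
  moreover have "- (1/2) * sqrt (1/2) + 1/2 = (2 - sqrt 2) / (4 :: real)"
    by (simp add: real_sqrt_divide field_simps)
  ultimately show ?thesis
    by (simp only:)
qed

text \<open>By the recurrence each consecutive ratio tends to 1/4, and the quotient is a telescoping
  product of \<open>j\<close> such ratios.\<close>

lemma shifted_catalan_shift_ratio:
  "(\<lambda>n. shifted_catalan n / shifted_catalan (n + j)) \<longlonglongrightarrow> (1/4) ^ j"
proof (induction j)
  case 0
  have "eventually (\<lambda>n. shifted_catalan n / shifted_catalan (n + 0) = 1) sequentially"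
    using eventually_gt_at_top[of 0]
    by eventually_elim (use shifted_catalan_pos in \<open>auto simp: less_imp_neq[THEN not_sym]\<close>)
  then show ?case
    by (simp add: tendsto_eventually)
next
  case (Suc j)
  have "(\<lambda>n. (real n + 1) / (4 * real n - 2)) \<longlonglongrightarrow> 1/4"
    by real_asymp
  moreover have "eventually (\<lambda>n. (real n + 1) / (4 * real n - 2) =
      shifted_catalan n / shifted_catalan (Suc n)) sequentially"
    using eventually_gt_at_top[of 0]
  proof eventually_elim
    case (elim n)
    then show ?case
      using shifted_catalan_pos[of n] by (simp add: shifted_catalan_Suc)
  qed
  ultimately have "(\<lambda>n. shifted_catalan n / shifted_catalan (Suc n)) \<longlonglongrightarrow> 1/4"
    by (rule Lim_transform_eventually)
  then have "(\<lambda>n. shifted_catalan (n + j) / shifted_catalan (Suc (n + j))) \<longlonglongrightarrow> 1/4"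
    by (rule LIMSEQ_ignore_initial_segment)
  from tendsto_mult[OF Suc this]
  have "(\<lambda>n. shifted_catalan n / shifted_catalan (n + j) *
      (shifted_catalan (n + j) / shifted_catalan (Suc (n + j)))) \<longlonglongrightarrow> (1/4) ^ Suc j"
    by (simp add: mult.commute)
  moreover have "eventually (\<lambda>n. shifted_catalan n / shifted_catalan (n + j) *
      (shifted_catalan (n + j) / shifted_catalan (Suc (n + j))) =
      shifted_catalan n / shifted_catalan (n + Suc j)) sequentially"
    using eventually_gt_at_top[of 0]
  proof eventually_elim
    case (elim n)
    then show ?case
      using shifted_catalan_pos[of "n + j"] by simp
  qed
  ultimately show ?case
    by (rule Lim_transform_eventually)
qed

lemma shifted_catalan_asymp_equiv:
  "shifted_catalan \<sim>[at_top] (\<lambda>n. 4 ^ n / (4 * sqrt (pi * real n ^ 3)))"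
proof (rule asymp_equivI')
  \<comment> \<open>The functional equation leads from Gamma(1/2) = sqrt(pi) to -1/2, once -1/2 is
    known not to be a pole.\<close>
  have Gamma: "Gamma (- (1/2) :: real) = - 2 * sqrt pi"
  proof -
    have "(- (1/2) :: real) \<notin> \<int>\<^sub>\<le>\<^sub>0"
    proof
      assume "(- (1/2) :: real) \<in> \<int>\<^sub>\<le>\<^sub>0"
      then obtain k where "- (1/2) = - real k"
        by (elim nonpos_Ints_cases')
      then have "real (2 * k) = real 1"
        by simp
      then show False
        unfolding of_nat_eq_iff by presburger
    qed
    from Gamma_plus1[OF this] show ?thesis
      by (simp add: Gamma_one_half_real)
  qed
  \<comment> \<open>The prefactor is Gamma(-1/2), which normalises the limit to 1.\<close>
  have "(\<lambda>n. - 2 * sqrt pi *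
      ((1/2 gchoose n) / ((-1) ^ n / exp ((1/2 + 1) * of_real (ln (real n)))))) \<longlonglongrightarrow>
      - 2 * sqrt pi * inverse (Gamma (- (1/2) :: real))"
    by (intro tendsto_mult tendsto_const gbinomial_asymptotic)
  then have "(\<lambda>n. - 2 * sqrt pi *
      ((1/2 gchoose n) / ((-1) ^ n / exp ((1/2 + 1) * ln (real n))))) \<longlonglongrightarrow> 1"
    by (simp add: Gamma)
  moreover have "eventually (\<lambda>n. - 2 * sqrt pi *
      ((1/2 gchoose n) / ((-1) ^ n / exp ((1/2 + 1) * ln (real n)))) =
      shifted_catalan n / (4 ^ n / (4 * sqrt (pi * real n ^ 3)))) sequentially"
    using eventually_gt_at_top[of 0]
  proof eventually_elim
    case (elim n)
    have "exp ((1/2 + 1) * ln (real n)) = (real n powr 3) powr (1/2)"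
      using elim by (simp only: powr_powr) (simp add: powr_def)
    also have "\<dots> = sqrt (real n ^ 3)"
      using elim by (simp add: powr_half_sqrt)
    finally have exp: "exp ((1/2 + 1) * ln (real n)) = sqrt (real n ^ 3)" .
    \<comment> \<open>The parity split resolves the signs of \<open>(-1) ^ n\<close> and
      \<open>(-4) ^ n\<close>.\<close>
    show ?case
      unfolding exp using elim
      by (cases "even n") (simp_all add: shifted_catalan_def real_sqrt_mult)
  qed
  ultimately show "(\<lambda>n. shifted_catalan n / (4 ^ n / (4 * sqrt (pi * real n ^ 3)))) \<longlonglongrightarrow> 1"
    by (rule Lim_transform_eventually)
qed

section \<open>Limit of the weighted convolution\<close>

text \<open>The weight \<open>2 ^ (n - j) - 1\<close> is split. The power gives the sum treated by
  Tannery's theorem; the -1 gives the plain convolution, which after division is exactly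
  \<open>(1/2) ^ n\<close> and vanishes in the limit.\<close>

lemma shifted_catalan_weighted_convolution:
  "(\<lambda>n. (\<Sum>j=1..<n. shifted_catalan j * ((2 ^ (n - j) - 1) * shifted_catalan (n - j))) /
      (2 ^ n * shifted_catalan n)) \<longlonglongrightarrow> (2 - sqrt 2) / 4"
proof -
  \<comment> \<open>Cutting off at \<open>j < n\<close> turns the finite sums of varying length into
    series over all \<open>j\<close>.\<close>
  define a where "a j n =
    (if j < n then shifted_catalan j * (shifted_catalan (n - j) / shifted_catalan n) / 2 ^ j else 0)"
    for j n
  have "(a j \<longlongrightarrow> shifted_catalan j / 8 ^ j) sequentially" for j
  proof -
    have "(\<lambda>n. shifted_catalan (n + j - j) / shifted_catalan (n + j)) \<longlonglongrightarrow> (1/4) ^ j"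
      using shifted_catalan_shift_ratio[of j] by simp
    then have "(\<lambda>n. shifted_catalan (n - j) / shifted_catalan n) \<longlonglongrightarrow> (1/4) ^ j"
      by (rule LIMSEQ_offset)
    then have "(\<lambda>n. shifted_catalan j * (shifted_catalan (n - j) / shifted_catalan n) / 2 ^ j)
        \<longlonglongrightarrow> shifted_catalan j * (1/4) ^ j / 2 ^ j"
      by (intro tendsto_intros) auto
    moreover have "shifted_catalan j * (1/4) ^ j / 2 ^ j = shifted_catalan j / 8 ^ j"
      by (simp add: power_divide flip: power_mult_distrib)
    moreover have "eventually (\<lambda>n.
        shifted_catalan j * (shifted_catalan (n - j) / shifted_catalan n) / 2 ^ j = a j n) sequentially"
      using eventually_gt_at_top[of j] by eventually_elim (simp add: a_def)
    ultimately show ?thesis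
      by (auto intro: Lim_transform_eventually)
  qed
  moreover have "norm (a j n) \<le> (1/2) ^ j" for j n
  proof (cases "j < n")
    case True
    then have "shifted_catalan n > 0" "shifted_catalan j * shifted_catalan (n - j) \<le> shifted_catalan n"
      by (auto intro: shifted_catalan_pos shifted_catalan_mult_le)
    then have "shifted_catalan j * (shifted_catalan (n - j) / shifted_catalan n) \<le> 1"
      by simp
    then have "shifted_catalan j * (shifted_catalan (n - j) / shifted_catalan n) / 2 ^ j \<le> 1 / 2 ^ j"
      by (rule divide_right_mono) simp
    then show ?thesis
      using True by (simp add: a_def power_divide shifted_catalan_nonneg)
  qed (simp add: a_def)
  moreover have "summable (\<lambda>j. (1/2 :: real) ^ j)"
    by (rule summable_geometric) simp
  ultimately have "(\<lambda>n. \<Sum>j. a j n) \<longlonglongrightarrow> (\<Sum>j. shifted_catalan j / 8 ^ j)"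
    using tannerys_theorem[of a "\<lambda>j. shifted_catalan j / 8 ^ j" sequentially "\<lambda>j. (1/2) ^ j"]
    by (simp add: case_prod_unfold)
  then have "(\<lambda>n. \<Sum>j. a j n) \<longlonglongrightarrow> (2 - sqrt 2) / 4"
    using sums_unique[OF shifted_catalan_sums] by simp
  moreover have "(\<lambda>n. (1/2 :: real) ^ n) \<longlonglongrightarrow> 0"
    by (rule LIMSEQ_realpow_zero) auto
  ultimately have "(\<lambda>n. (\<Sum>j. a j n) - (1/2) ^ n) \<longlonglongrightarrow> (2 - sqrt 2) / 4 - 0"
    by (rule tendsto_diff)
  then have lim: "(\<lambda>n. (\<Sum>j. a j n) - (1/2) ^ n) \<longlonglongrightarrow> (2 - sqrt 2) / 4"
    by simp
  have "eventually (\<lambda>n. (\<Sum>j. a j n) - (1/2) ^ n =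
      (\<Sum>j=1..<n. shifted_catalan j * ((2 ^ (n - j) - 1) * shifted_catalan (n - j))) /
      (2 ^ n * shifted_catalan n)) sequentially"
    using eventually_ge_at_top[of 2]
  proof eventually_elim
    case (elim n)
    have pos: "shifted_catalan n > 0"
      using elim by (intro shifted_catalan_pos) auto
    \<comment> \<open>Terms with \<open>j >= n\<close> vanish by the cut-off, the term
      \<open>j = 0\<close> by \<open>shifted_catalan 0 = 0\<close>.\<close>
    have "(\<Sum>j. a j n) = (\<Sum>j\<in>{1..<n}. a j n)"
      by (rule suminf_finite) (auto simp: a_def shifted_catalan_0 not_less_eq_eq)
    also have "\<dots> = (\<Sum>j=1..<n. shifted_catalan j * (2 ^ (n - j) * shifted_catalan (n - j))) /
        (2 ^ n * shifted_catalan n)"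
      unfolding sum_divide_distrib by (intro sum.cong refl) (auto simp: a_def power_diff)
    finally have *: "(\<Sum>j. a j n) =
      (\<Sum>j=1..<n. shifted_catalan j * (2 ^ (n - j) * shifted_catalan (n - j))) /
        (2 ^ n * shifted_catalan n)" .
    have "(1/2) ^ n = (\<Sum>j=1..<n. shifted_catalan j * shifted_catalan (n - j)) /
        (2 ^ n * shifted_catalan n)"
      using elim pos by (simp add: shifted_catalan_convolution[of n, simplified] power_divide)
    with * show ?case
      by (simp add: algebra_simps sum_subtractf diff_divide_distrib)
  qed
  with lim show ?thesis
    by (rule Lim_transform_eventually)
qed

text \<open>Splitting at the outermost connective gives the Catalan convolution; the index
  \<open>Suc j - i\<close> is the number of variables.\<close>

lemma card_bracketings:
  "i \<le> j \<Longrightarrow> real (card {\<theta>. bracketing i j \<theta>}) = shifted_catalan (Suc j - i)"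
proof (induction "j - i" arbitrary: i j rule: less_induct)
  case less
  show ?case
  proof (cases "i = j")
    case True
    then show ?thesis
      by (simp add: bracketings_single shifted_catalan_1)
  next
    case False
    with less.prems have "i < j" by simp
    have "card {\<theta>. bracketing i j \<theta>} = (\<Sum>m=i..<j. card (split_bracketings i m j))"
      unfolding bracketings_split[OF \<open>i < j\<close>]
      by (rule card_UN_disjoint) (auto simp: finite_split_bracketings split_bracketings_disjoint)
    then have "real (card {\<theta>. bracketing i j \<theta>}) =
        (\<Sum>m=i..<j. real (card {\<psi>. bracketing i m \<psi>}) * real (card {\<phi>. bracketing (Suc m) j \<phi>}))"
      by (simp add: card_split_bracketings)
    also have "\<dots> = (\<Sum>m=i..<j. shifted_catalan (Suc m - i) * shifted_catalan (j - m))"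
    proof (rule sum.cong)
      fix m assume "m \<in> {i..<j}"
      then have m: "i \<le> m" "m < j"
        by auto
      have "real (card {\<psi>. bracketing i m \<psi>}) = shifted_catalan (Suc m - i)"
        by (rule less.hyps) (use m in auto)
      moreover have "real (card {\<phi>. bracketing (Suc m) j \<phi>}) = shifted_catalan (Suc j - Suc m)"
        by (rule less.hyps) (use m in auto)
      ultimately show "real (card {\<psi>. bracketing i m \<psi>}) * real (card {\<phi>. bracketing (Suc m) j \<phi>}) =
          shifted_catalan (Suc m - i) * shifted_catalan (j - m)"
        by (simp only: diff_Suc_Suc)
    qed simp
    \<comment> \<open>The new index \<open>k\<close> is the number of variables in the left
      part.\<close>
    also have "\<dots> = (\<Sum>k=1..<Suc j - i. shifted_catalan k * shifted_catalan (Suc j - i - k))"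
      using \<open>i < j\<close>
      by (intro sum.reindex_bij_witness[of _ "\<lambda>k. k + i - 1" "\<lambda>m. Suc m - i"])
        (auto intro!: arg_cong2[where f = "(*)"] arg_cong[where f = shifted_catalan])
    also have "\<dots> = shifted_catalan (Suc j - i)"
      using \<open>i < j\<close> by (intro shifted_catalan_convolution) auto
    finally show ?thesis .
  qed
qed


section \<open>Counting rows\<close>

text \<open>The valuations that are false off \<open>A\<close> form \<open>?S\<close>; only the
  all-false one, the sole member of \<open>?T\<close>, has to be removed.\<close>

lemma card_valuations_supported:
  assumes "A \<subseteq> I" "finite I"
  shows "card {v \<in> I \<rightarrow>\<^sub>E UNIV. (\<exists>k\<in>A. v k) \<and> \<not> (\<exists>k\<in>I - A. v k)} = 2 ^ card A - 1"
proof -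
  let ?S = "\<Pi>\<^sub>E k\<in>I. if k \<in> A then UNIV else {False}" and ?T = "\<Pi>\<^sub>E k\<in>I. {False}"
  have "card ?S = (\<Prod>k\<in>I. if k \<in> A then 2 else 1)"
    using assms by (subst card_PiE) (auto intro!: prod.cong)
  also have "\<dots> = (\<Prod>k\<in>A. 2)"
    using assms by (intro prod.mono_neutral_cong_right) auto
  finally have "card ?S = 2 ^ card A"
    by simp
  moreover have "card ?T = 1"
    using assms by (subst card_PiE) auto
  moreover have "?T \<subseteq> ?S"
    by (intro PiE_mono) auto
  moreover have "finite ?T"
    using assms by (intro finite_PiE) auto
  moreover have "{v \<in> I \<rightarrow>\<^sub>E UNIV. (\<exists>k\<in>A. v k) \<and> \<not> (\<exists>k\<in>I - A. v k)} = ?S - ?T"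
    unfolding set_eq_iff mem_Collect_eq Diff_iff PiE_iff
    using assms(1) by (auto split: if_splits)
  ultimately show ?thesis
    by (simp add: card_Diff_subset)
qed

text \<open>Common count for both cases: \<open>A m\<close> is the block of variables of the side
  that must be true, while the rest must be false. This condition depends only on the split point,
  so for each \<open>m\<close> the rows form a product set.\<close>

lemma card_split_rows:
  assumes "n \<ge> 2"
    and R: "\<And>m \<psi> \<phi> v. bracketing 1 m \<psi> \<Longrightarrow> bracketing (Suc m) n \<phi> \<Longrightarrow> R v \<psi> \<phi> \<longleftrightarrow>
        (\<exists>k\<in>A m. v k) \<and> \<not> (\<exists>k\<in>{1..n} - A m. v k)"
    and A: "\<And>m. m \<in> {1..<n} \<Longrightarrow> A m \<subseteq> {1..n}"
  shows "real (card {(\<theta>, v) \<in> Defs.rows n. \<exists>\<psi> \<phi>. \<theta> = MImp \<psi> \<phi> \<and> R v \<psi> \<phi>}) =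
    (\<Sum>m=1..<n. shifted_catalan m * shifted_catalan (n - m) * (2 ^ card (A m) - 1))"
proof -
  define V where "V m = {v \<in> {1..n} \<rightarrow>\<^sub>E UNIV. (\<exists>k\<in>A m. v k) \<and> \<not> (\<exists>k\<in>{1..n} - A m. v k)}" for m
  have "finite ({1..n} \<rightarrow>\<^sub>E (UNIV :: bool set))"
    by (intro finite_PiE) auto
  then have fin: "finite (V m)" for m
    by (rule finite_subset[rotated]) (auto simp: V_def)
  have "{(\<theta>, v) \<in> Defs.rows n. \<exists>\<psi> \<phi>. \<theta> = MImp \<psi> \<phi> \<and> R v \<psi> \<phi>} =
      (\<Union>m\<in>{1..<n}. split_bracketings 1 m n \<times> V m)"
    using assms(1) R
    by (auto simp: Defs.rows_def bracketings_split split_bracketings_def V_def)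
  moreover have "card (\<Union>m\<in>{1..<n}. split_bracketings 1 m n \<times> V m) =
      (\<Sum>m=1..<n. card (split_bracketings 1 m n \<times> V m))"
  proof (rule card_UN_disjoint)
    show "\<forall>m\<in>{1..<n}. finite (split_bracketings 1 m n \<times> V m)"
      by (simp add: finite_split_bracketings fin)
    show "\<forall>m\<in>{1..<n}. \<forall>m'\<in>{1..<n}. m \<noteq> m' \<longrightarrow>
        (split_bracketings 1 m n \<times> V m) \<inter> (split_bracketings 1 m' n \<times> V m') = {}"
      by (simp add: Times_Int_Times split_bracketings_disjoint)
  qed simp
  ultimately have "card {(\<theta>, v) \<in> Defs.rows n. \<exists>\<psi> \<phi>. \<theta> = MImp \<psi> \<phi> \<and> R v \<psi> \<phi>} =
      (\<Sum>m=1..<n. card (split_bracketings 1 m n \<times> V m))"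
    by (simp only:)
  also have "real \<dots> = (\<Sum>m=1..<n. shifted_catalan m * shifted_catalan (n - m) * (2 ^ card (A m) - 1))"
    unfolding of_nat_sum
  proof (rule sum.cong)
    fix m assume m: "m \<in> {1..<n}"
    then have "real (card (V m)) = 2 ^ card (A m) - 1"
      unfolding V_def using A by (subst card_valuations_supported) (auto simp: of_nat_diff)
    with m show "real (card (split_bracketings 1 m n \<times> V m)) =
        shifted_catalan m * shifted_catalan (n - m) * (2 ^ card (A m) - 1)"
      by (simp add: card_cartesian_product card_split_bracketings card_bracketings)
  qed simp
  finally show ?thesis .
qed

lemma k_case2_eq:
  assumes "n \<ge> 2"
  shows "real (k_case2 n) =
    (\<Sum>j=1..<n. shifted_catalan j * ((2 ^ (n - j) - 1) * shifted_catalan (n - j)))"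
proof -
  have "real (k_case2 n) =
      (\<Sum>m=1..<n. shifted_catalan m * shifted_catalan (n - m) * (2 ^ card {1..m} - 1))"
    unfolding k_case2_def
  proof (rule card_split_rows[OF assms])
    fix m \<psi> \<phi> v assume b: "bracketing 1 m \<psi>" "bracketing (Suc m) n \<phi>"
    then have "{1..n} - {1..m} = {Suc m..n}"
      by auto
    then show "eval v \<psi> \<and> \<not> eval v \<phi> \<longleftrightarrow> (\<exists>k\<in>{1..m}. v k) \<and> \<not> (\<exists>k\<in>{1..n} - {1..m}. v k)"
      using b by (simp add: bracketing_eval_iff)
  qed auto
  also have "\<dots> = (\<Sum>j=1..<n. shifted_catalan j * ((2 ^ (n - j) - 1) * shifted_catalan (n - j)))"
    \<comment> \<open>Here the true block has \<open>m\<close> variables; the reflection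
      \<open>j = n - m\<close> gives the same sum as in case 3.\<close>
    by (intro sum.reindex_bij_witness[of _ "\<lambda>j. n - j" "\<lambda>m. n - m"]) auto
  finally show ?thesis .
qed

lemma k_case3_eq:
  assumes "n \<ge> 2"
  shows "real (k_case3 n) =
    (\<Sum>j=1..<n. shifted_catalan j * ((2 ^ (n - j) - 1) * shifted_catalan (n - j)))"
proof -
  have "real (k_case3 n) =
      (\<Sum>m=1..<n. shifted_catalan m * shifted_catalan (n - m) * (2 ^ card {Suc m..n} - 1))"
    unfolding k_case3_def
  proof (rule card_split_rows[OF assms])
    fix m \<psi> \<phi> v assume b: "bracketing 1 m \<psi>" "bracketing (Suc m) n \<phi>"
    then have "{1..n} - {Suc m..n} = {1..m}"
      by (auto dest: bracketing_le)
    then show "\<not> eval v \<psi> \<and> eval v \<phi> \<longleftrightarrow>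
        (\<exists>k\<in>{Suc m..n}. v k) \<and> \<not> (\<exists>k\<in>{1..n} - {Suc m..n}. v k)"
      using b by (auto simp: bracketing_eval_iff)
  qed auto
  then show ?thesis
    by (simp add: mult_ac)
qed

section \<open>Transfer to the asymptotic formula\<close>

lemma asymp_equiv_of_weighted_convolution:
  fixes f :: "nat \<Rightarrow> real"
  assumes "\<And>n. n \<ge> 2 \<Longrightarrow>
    f n = (\<Sum>j=1..<n. shifted_catalan j * ((2 ^ (n - j) - 1) * shifted_catalan (n - j)))"
  shows "f \<sim>[at_top] (\<lambda>n. ((2 - sqrt 2) / 4) * (2 ^ (3 * n - 2) / sqrt (pi * real n ^ 3)))"
proof -
  have "eventually (\<lambda>n.
      (\<Sum>j=1..<n. shifted_catalan j * ((2 ^ (n - j) - 1) * shifted_catalan (n - j))) /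
      (2 ^ n * shifted_catalan n) = f n / (2 ^ n * shifted_catalan n)) sequentially"
    using eventually_ge_at_top[of 2] by eventually_elim (simp add: assms)
  with shifted_catalan_weighted_convolution
  have "(\<lambda>n. f n / (2 ^ n * shifted_catalan n)) \<longlonglongrightarrow> (2 - sqrt 2) / 4"
    by (rule Lim_transform_eventually)
  \<comment> \<open>A quotient limit yields an asymptotic equivalence only if it is nonzero.\<close>
  moreover have "(2 - sqrt 2) / 4 \<noteq> (0 :: real)"
    using sqrt2_less_2 by simp
  ultimately have "f \<sim>[at_top] (\<lambda>n. (2 - sqrt 2) / 4 * (2 ^ n * shifted_catalan n))"
    by (rule asymp_equivI'_const)
  also have "\<dots> \<sim>[at_top] (\<lambda>n. (2 - sqrt 2) / 4 * (2 ^ n * (4 ^ n / (4 * sqrt (pi * real n ^ 3)))))"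
    by (intro asymp_equiv_mult asymp_equiv_refl shifted_catalan_asymp_equiv)
  also have "\<dots> \<sim>[at_top] (\<lambda>n. (2 - sqrt 2) / 4 * (2 ^ (3 * n - 2) / sqrt (pi * real n ^ 3)))"
  proof (rule asymp_equiv_refl_ev)
    show "eventually (\<lambda>n. (2 - sqrt 2) / 4 * (2 ^ n * (4 ^ n / (4 * sqrt (pi * real n ^ 3)))) =
        (2 - sqrt 2) / 4 * (2 ^ (3 * n - 2) / sqrt (pi * real n ^ 3))) at_top"
      using eventually_ge_at_top[of 1]
    proof eventually_elim
      case (elim n)
      \<comment> \<open>The subtraction is truncated; \<open>n >= 1\<close> ensures
        \<open>3 * n >= 2\<close>.\<close>
      have "(2 :: real) ^ (3 * n - 2) = 2 ^ n * 4 ^ n / 4"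
        using elim by (simp add: power_diff power_mult flip: power_mult_distrib)
      then show ?case
        by (simp only:) simp
    qed
  qed
  finally show ?thesis .
qed

theorem theorem7p12:
  shows "((\<lambda>n. real (k_case2 n)) \<sim>[at_top]
           (\<lambda>n. ((2 - sqrt 2) / 4) * (2 ^ (3 * n - 2) / sqrt (pi * real n ^ 3)))) \<and>
         ((\<lambda>n. real (k_case3 n)) \<sim>[at_top]
           (\<lambda>n. ((2 - sqrt 2) / 4) * (2 ^ (3 * n - 2) / sqrt (pi * real n ^ 3))))"
  by (intro conjI asymp_equiv_of_weighted_convolution k_case2_eq k_case3_eq)

end
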